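(* Let $p$ be a prime, let $m$ be an odd positive integer with $p\nmid m$ and $p<m/2$, let $K$ be a field of characteristic $p$ containing all $m$-th roots of unity, and let $c\in K$. Let $\tau=\rho_p$ be the two-dimensional representation of the dihedral group $D_m=G(m,m,2)$. Then $x_1^p\otimes e_1,\ x_2^p\otimes e_2,\ x_1^{3p}\otimes e_2,\ x_2^{3p}\otimes e_1\in J_c$.
   Context: Let $\zeta\in K$ be a primitive $m$-th root of unity. The reflections of $D_m$ are $s_k$, $0\le k<m$, acting on $\mathfrak h^*=Kx_1\oplus Kx_2$ by the matrix $\begin{bmatrix}0&\zeta^{-k}\\ \zeta^{k}&0\end{bmatrix}$, i.e. $s_k(x_1)=\zeta^kx_2$, $s_k(x_2)=\zeta^{-k}x_1$; they generate $D_m$, and $\alpha_{s_k}=x_1-\zeta^kx_2$ spans the image of $1-s_k$. Since $m$ is odd all reflections are conjugate, so there is a single parameter $c$. For $1\le a<m/2$, the irreducible representation $\rho_a$ of $D_m$ has basis $e_1,e_2$ with $s_k$ acting by $\begin{bmatrix}0&\zeta^{-ak}\\ \zeta^{ak}&0\end{bmatrix}$, i.e. $s_k(e_1)=\zeta^{ak}e_2$, $s_k(e_2)=\zeta^{-ak}e_1$; here $a=p$. Let $y_1,y_2$ be the basis of $\mathfrak h$ dual to $x_1,x_2$. The Verma module of the rational Cherednik algebra $H_{1,c}(D_m,\mathfrak h)$ is $M_c(\tau)=K[x_1,x_2]\otimes\tau$, graded by polynomial degree, where $x_i$ acts by multiplication, $D_m$ acts diagonally, and $y_i$ acts by the Dunkl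 operator $D_i(f\otimes v)=\frac{\partial f}{\partial x_i}\otimes v-\sum_{k=0}^{m-1}c\,(y_i,\alpha_{s_k})\frac{f-s_k(f)}{\alpha_{s_k}}\otimes s_k(v)$, where $(y_1,\alpha_{s_k})=1$ and $(y_2,\alpha_{s_k})=-\zeta^k$. $J_c$ is the unique maximal proper graded submodule of $M_c(\tau)$ (submodule: stable under multiplication by $x_1,x_2$, under $D_m$, and under $D_1,D_2$). *)

theory Defs
  imports "HOL-Computational_Algebra.Computational_Algebra" "HOL-Library.Product_Plus"
begin

text \<open>
  The polynomial ring \<open>K[x1, x2]\<close> is \<open>K[x1][x2]\<close>: the variable of the inner polynomial is \<open>x1\<close>,
  that of the outer one is \<open>x2\<close>, so \<open>coeff (coeff f j) i\<close> is the coefficient of \<open>x1^i x2^j\<close>.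
\<close>

type_synonym 'a bipoly = "'a poly poly"

definition x1 :: "'a::field bipoly" where "x1 = [:[:0, 1:]:]"

definition x2 :: "'a::field bipoly" where "x2 = [:0, 1:]"

definition bconst :: "'a::field \<Rightarrow> 'a bipoly" where "bconst a = [:[:a:]:]"

text \<open>The value \<open>f(X, Y)\<close>, i.e. the \<open>K\<close>-algebra map with \<open>x1 \<mapsto> X\<close> and \<open>x2 \<mapsto> Y\<close>.\<close>

definition bsubst :: "'a::field bipoly \<Rightarrow> 'a bipoly \<Rightarrow> 'a bipoly \<Rightarrow> 'a bipoly" where
  "bsubst X Y f = poly (map_poly (\<lambda>g. poly (map_poly bconst g) X) f) Y"

definition pd1 :: "'a::field bipoly \<Rightarrow> 'a bipoly" where "pd1 f = map_poly pderiv f"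

definition pd2 :: "'a::field bipoly \<Rightarrow> 'a bipoly" where "pd2 f = pderiv f"

text \<open>The homogeneous component of total degree \<open>d\<close>.\<close>

definition bhom :: "nat \<Rightarrow> 'a::field bipoly \<Rightarrow> 'a bipoly" where
  "bhom d f = (\<Sum>j\<le>d. monom (monom (coeff (coeff f j) (d - j)) (d - j)) j)"

definition primitive_unity_root :: "nat \<Rightarrow> 'a::field \<Rightarrow> bool" where
  "primitive_unity_root m \<zeta> \<longleftrightarrow> m > 0 \<and> \<zeta> ^ m = 1 \<and> (\<forall>j. 0 < j \<and> j < m \<longrightarrow> \<zeta> ^ j \<noteq> 1)"

definition refl_poly :: "'a::field \<Rightarrow> nat \<Rightarrow> 'a bipoly \<Rightarrow> 'a bipoly" where
  "refl_poly \<zeta> k = bsubst (bconst (\<zeta> ^ k) * x2) (bconst (inverse \<zeta> ^ k) * x1)"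

definition root_form :: "'a::field \<Rightarrow> nat \<Rightarrow> 'a bipoly" where
  "root_form \<zeta> k = x1 - bconst (\<zeta> ^ k) * x2"

text \<open>
  The underlying space of \<open>\<rho>\<^sub>a\<close> is \<open>K \<times> K\<close>, with \<open>(u, v)\<close> standing for \<open>u e1 + v e2\<close>.
\<close>

definition e1 :: "'a::field \<times> 'a" where "e1 = (1, 0)"

definition e2 :: "'a::field \<times> 'a" where "e2 = (0, 1)"

definition refl_rho :: "'a::field \<Rightarrow> nat \<Rightarrow> nat \<Rightarrow> 'a \<times> 'a \<Rightarrow> 'a \<times> 'a" where
  "refl_rho \<zeta> a k v = (inverse \<zeta> ^ (a * k) * snd v, \<zeta> ^ (a * k) * fst v)"

text \<open>
  The underlying space of \<open>M\<^sub>c(\<rho>\<^sub>a) = K[x1, x2] \<otimes> \<rho>\<^sub>a\<close> is \<open>K[x1, x2] \<times> K[x1, x2]\<close>,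
  with \<open>(f, g)\<close> standing for \<open>f \<otimes> e1 + g \<otimes> e2\<close>.
\<close>

type_synonym 'a verma = "'a bipoly \<times> 'a bipoly"

definition tensor :: "'a::field bipoly \<Rightarrow> 'a \<times> 'a \<Rightarrow> 'a verma" where
  "tensor f v = (f * bconst (fst v), f * bconst (snd v))"

definition vmult :: "'a::field bipoly \<Rightarrow> 'a verma \<Rightarrow> 'a verma" where
  "vmult h w = (h * fst w, h * snd w)"

definition refl_verma :: "'a::field \<Rightarrow> nat \<Rightarrow> nat \<Rightarrow> 'a verma \<Rightarrow> 'a verma" where
  "refl_verma \<zeta> a k w =
     tensor (refl_poly \<zeta> k (fst w)) (refl_rho \<zeta> a k e1) +
     tensor (refl_poly \<zeta> k (snd w)) (refl_rho \<zeta> a k e2)"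

text \<open>
  The operators by which the elements of \<open>D\<^sub>m\<close>, the group generated by its reflections, act
  on \<open>M\<^sub>c(\<rho>\<^sub>a)\<close>; since reflections are involutions, closure under inverses is automatic.
\<close>

inductive_set dihedral_ops :: "'a::field \<Rightarrow> nat \<Rightarrow> nat \<Rightarrow> ('a verma \<Rightarrow> 'a verma) set"
  for \<zeta> :: 'a and m a :: nat where
  one: "id \<in> dihedral_ops \<zeta> m a"
| refl: "k < m \<Longrightarrow> refl_verma \<zeta> a k \<in> dihedral_ops \<zeta> m a"
| mult: "g \<in> dihedral_ops \<zeta> m a \<Longrightarrow> h \<in> dihedral_ops \<zeta> m a \<Longrightarrow> g \<circ> h \<in> dihedral_ops \<zeta> m a"

text \<open>
  The Dunkl operator on \<open>f \<otimes> v\<close>, where \<open>pd\<close> is the partial derivative in the direction \<open>y\<close> and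
  \<open>pairing k\<close> is \<open>(y, \<alpha>\<^sub>k)\<close> for the root form \<open>\<alpha>\<^sub>k\<close> of the reflection \<open>s\<^sub>k\<close>. The division
  \<open>div\<close> is exact, see the lemma \<open>root_form_dvd\<close> below.
\<close>

definition dunkl_tensor ::
  "('a bipoly \<Rightarrow> 'a bipoly) \<Rightarrow> (nat \<Rightarrow> 'a) \<Rightarrow> 'a \<Rightarrow> nat \<Rightarrow> nat \<Rightarrow> 'a \<Rightarrow>
     'a::field bipoly \<Rightarrow> 'a \<times> 'a \<Rightarrow> 'a verma" where
  "dunkl_tensor pd pairing \<zeta> m a c f v =
     tensor (pd f) v -
     (\<Sum>k<m. tensor (bconst (c * pairing k) * ((f - refl_poly \<zeta> k f) div root_form \<zeta> k))
                     (refl_rho \<zeta> a k v))"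

definition dunkl1 :: "'a::field \<Rightarrow> nat \<Rightarrow> nat \<Rightarrow> 'a \<Rightarrow> 'a verma \<Rightarrow> 'a verma" where
  "dunkl1 \<zeta> m a c w =
     dunkl_tensor pd1 (\<lambda>k. 1) \<zeta> m a c (fst w) e1 + dunkl_tensor pd1 (\<lambda>k. 1) \<zeta> m a c (snd w) e2"

definition dunkl2 :: "'a::field \<Rightarrow> nat \<Rightarrow> nat \<Rightarrow> 'a \<Rightarrow> 'a verma \<Rightarrow> 'a verma" where
  "dunkl2 \<zeta> m a c w =
     dunkl_tensor pd2 (\<lambda>k. - (\<zeta> ^ k)) \<zeta> m a c (fst w) e1 +
     dunkl_tensor pd2 (\<lambda>k. - (\<zeta> ^ k)) \<zeta> m a c (snd w) e2"

definition verma_submodule :: "'a::field \<Rightarrow> nat \<Rightarrow> nat \<Rightarrow> 'a \<Rightarrow> 'a verma set \<Rightarrow> bool" where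
  "verma_submodule \<zeta> m a c N \<longleftrightarrow>
     0 \<in> N \<and>
     (\<forall>v\<in>N. \<forall>w\<in>N. v + w \<in> N) \<and>
     (\<forall>b. \<forall>w\<in>N. vmult (bconst b) w \<in> N) \<and>
     (\<forall>w\<in>N. vmult x1 w \<in> N \<and> vmult x2 w \<in> N) \<and>
     (\<forall>g\<in>dihedral_ops \<zeta> m a. \<forall>w\<in>N. g w \<in> N) \<and>
     (\<forall>w\<in>N. dunkl1 \<zeta> m a c w \<in> N \<and> dunkl2 \<zeta> m a c w \<in> N)"

definition verma_graded :: "'a::field verma set \<Rightarrow> bool" where
  "verma_graded N \<longleftrightarrow> (\<forall>w\<in>N. \<forall>d. (bhom d (fst w), bhom d (snd w)) \<in> N)"

definition proper_graded_submodule ::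
  "'a::field \<Rightarrow> nat \<Rightarrow> nat \<Rightarrow> 'a \<Rightarrow> 'a verma set \<Rightarrow> bool" where
  "proper_graded_submodule \<zeta> m a c N \<longleftrightarrow>
     verma_submodule \<zeta> m a c N \<and> verma_graded N \<and> N \<noteq> UNIV"

definition maximal_proper_graded_submodule ::
  "'a::field \<Rightarrow> nat \<Rightarrow> nat \<Rightarrow> 'a \<Rightarrow> 'a verma set \<Rightarrow> bool" where
  "maximal_proper_graded_submodule \<zeta> m a c N \<longleftrightarrow>
     proper_graded_submodule \<zeta> m a c N \<and>
     (\<forall>N'. proper_graded_submodule \<zeta> m a c N' \<longrightarrow> N \<subseteq> N' \<longrightarrow> N' = N)"

definition J :: "'a::field \<Rightarrow> nat \<Rightarrow> nat \<Rightarrow> 'a \<Rightarrow> 'a verma set" where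
  "J \<zeta> m a c = (THE N. maximal_proper_graded_submodule \<zeta> m a c N)"

lemma bsubst_0: "bsubst X Y 0 = 0"
  by (simp add: bsubst_def)

lemma bsubst_pCons:
  "bsubst X Y (pCons g f) = poly (map_poly bconst g) X + Y * bsubst X Y f"
  by (simp add: bsubst_def map_poly_pCons)

lemma eval_bconst_pCons:
  "poly (map_poly bconst (pCons b g)) X = bconst b + X * poly (map_poly bconst g) X"
  by (simp add: bconst_def map_poly_pCons)

lemma root_form_dvd:
  fixes \<zeta> :: "'a::field"
  assumes "\<zeta> \<noteq> 0"
  shows "root_form \<zeta> k dvd f - refl_poly \<zeta> k f"
proof -
  let ?r = "root_form \<zeta> k"
  let ?X = "bconst (\<zeta> ^ k) * x2" and ?Y = "bconst (inverse \<zeta> ^ k) * x1"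
  have X: "x1 - ?X = ?r"
    by (simp add: root_form_def)
  have "bconst (inverse \<zeta> ^ k) * bconst (\<zeta> ^ k) = (1 :: 'a bipoly)"
    using assms by (simp add: bconst_def one_pCons flip: power_mult_distrib)
  hence Y: "x2 - ?Y = - bconst (inverse \<zeta> ^ k) * ?r"
    by (simp add: root_form_def algebra_simps)
  have inner: "?r dvd [:g:] - poly (map_poly bconst g) ?X" for g :: "'a poly"
  proof (induction g)
    case 0
    then show ?case by simp
  next
    case (pCons b g)
    let ?G = "poly (map_poly bconst g) ?X"
    have "[:pCons b g:] = bconst b + x1 * [:g:]"
      by (simp add: bconst_def x1_def)
    hence "[:pCons b g:] - poly (map_poly bconst (pCons b g)) ?X = ?r * [:g:] + ?X * ([:g:] - ?G)"
      by (simp only: eval_bconst_pCons flip: X) (simp add: algebra_simps)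
    with pCons show ?case
      by (metis dvd_add dvd_mult dvd_triv_left)
  qed
  show ?thesis
    unfolding refl_poly_def
  proof (induction f)
    case 0
    then show ?case by (simp add: bsubst_0)
  next
    case (pCons g f)
    let ?F = "bsubst ?X ?Y f" and ?G = "poly (map_poly bconst g) ?X"
    have "pCons g f = [:g:] + x2 * f"
      by (simp add: x2_def)
    hence "pCons g f - bsubst ?X ?Y (pCons g f) = ([:g:] + x2 * f) - (?G + ?Y * ?F)"
      by (metis bsubst_pCons)
    also have "\<dots> = ([:g:] - ?G) + (x2 - ?Y) * f + ?Y * (f - ?F)"
      by (simp only: algebra_simps)
    finally have "pCons g f - bsubst ?X ?Y (pCons g f) =
      ([:g:] - ?G) + (x2 - ?Y) * f + ?Y * (f - ?F)" .
    moreover have "?r dvd x2 - ?Y"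
      unfolding Y by simp
    ultimately show ?case
      using inner[of g] pCons by (metis dvd_add dvd_mult dvd_mult2)
  qed
qed

end

(* The four vectors generate, over K[x1, x2], the graded space N = I (x) e1 + I' (x) e2 with
   I = (x1^p, x2^(3p)) and I' = (x2^p, x1^(3p)), which does not contain the degree 0 part. Since the
   Dunkl operators obey a Leibniz rule twisted by the reflections, N is stable under them as soon as
   they map the four generators into N. The partial derivatives of the generators vanish in
   characteristic p, and after summing over the reflections only those monomials survive whose
   character sum is nonzero; as 2p < m, all of these lie in N. Because rho_p is irreducible, every
   proper graded submodule vanishes in degree 0, so the sum of all of them is J. *)

theory Submission
  imports Defs
begin

section \<open>Substitution homomorphisms and the action of reflections on polynomials\<close>

lemma bconst_0 [simp]: "bconst 0 = 0"
  and bconst_1 [simp]: "bconst 1 = 1"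
  and bconst_add: "bconst (a + b) = bconst a + bconst b"
  and bconst_minus: "bconst (- a) = - bconst a"
  and bconst_mult: "bconst (a * b) = bconst a * bconst b"
  by (simp_all add: bconst_def one_pCons)

lemma bconst_power: "bconst (a ^ n) = bconst a ^ n"
  by (induction n) (simp_all add: bconst_mult)

lemma bconst_sum: "bconst (sum f A) = (\<Sum>k\<in>A. bconst (f k))"
  by (induction A rule: infinite_finite_induct) (simp_all add: bconst_add)

lemma x1_power: "x1 ^ n = [:monom 1 n:]"
  by (induction n) (simp_all add: x1_def one_pCons monom_0 monom_Suc)

lemma x2_power: "x2 ^ n = monom 1 n"
  by (simp add: x2_def monom_altdef)

text \<open>\<open>bsubst\<close> is a nested evaluation: each coefficient in K[x1] is evaluated at
  \<open>X\<close>, then the outer polynomial at \<open>Y\<close>. The inner layer being a ring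
  homomorphism is what the inductions for \<open>bsubst_add\<close> and \<open>bsubst_mult\<close>
  rest on.\<close>

lemma poly_map_bconst_hom:
  fixes X :: "'a::field bipoly"
  shows "poly (map_poly bconst (f + g)) X = poly (map_poly bconst f) X + poly (map_poly bconst g) X"
    and "poly (map_poly bconst (f * g)) X = poly (map_poly bconst f) X * poly (map_poly bconst g) X"
proof -
  show add: "poly (map_poly bconst (f + g)) X =
      poly (map_poly bconst f) X + poly (map_poly bconst g) X" for f g :: "'a poly"
    by (induction f g rule: poly_induct2)
      (simp_all add: eval_bconst_pCons bconst_add algebra_simps)
  have smult: "poly (map_poly bconst (smult a g)) X = bconst a * poly (map_poly bconst g) X" for a g
    by (induction g) (simp_all add: eval_bconst_pCons bconst_mult algebra_simps)
  show "poly (map_poly bconst (f * g)) X = poly (map_poly bconst f) X * poly (map_poly bconst g) X"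
    by (induction f) (simp_all add: eval_bconst_pCons add smult algebra_simps)
qed

lemma bsubst_add: "bsubst X Y (f + g) = bsubst X Y f + bsubst X Y g"
  by (induction f g rule: poly_induct2)
    (simp_all add: bsubst_0 bsubst_pCons poly_map_bconst_hom algebra_simps)

lemma bsubst_mult: "bsubst X Y (f * g) = bsubst X Y f * bsubst X Y g"
proof -
  have smult: "bsubst X Y (smult a h) = poly (map_poly bconst a) X * bsubst X Y h" for a h
    by (induction h) (simp_all add: bsubst_0 bsubst_pCons poly_map_bconst_hom algebra_simps)
  show ?thesis
    by (induction f) (simp_all add: bsubst_0 bsubst_pCons bsubst_add smult algebra_simps)
qed

lemma bsubst_bconst: "bsubst X Y (bconst a) = bconst a"
  using eval_bconst_pCons[of a 0 X] by (simp add: bconst_def[of a] bsubst_pCons bsubst_0)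

lemma bsubst_x1: "bsubst X Y x1 = X"
  using eval_bconst_pCons[of 0 1 X] eval_bconst_pCons[of 1 0 X]
  by (simp add: x1_def bsubst_pCons bsubst_0 flip: one_pCons)

lemma bsubst_x2: "bsubst X Y x2 = Y"
  using bsubst_bconst[of X Y 1]
  by (simp add: x2_def bsubst_pCons bsubst_0 flip: one_pCons)

lemma refl_poly_add: "refl_poly \<zeta> k (f + g) = refl_poly \<zeta> k f + refl_poly \<zeta> k g"
  and refl_poly_mult: "refl_poly \<zeta> k (f * g) = refl_poly \<zeta> k f * refl_poly \<zeta> k g"
  and refl_poly_bconst: "refl_poly \<zeta> k (bconst a) = bconst a"
  and refl_poly_x1: "refl_poly \<zeta> k x1 = bconst (\<zeta> ^ k) * x2"
  and refl_poly_x2: "refl_poly \<zeta> k x2 = bconst (inverse \<zeta> ^ k) * x1"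
  by (simp_all add: refl_poly_def bsubst_add bsubst_mult bsubst_bconst bsubst_x1 bsubst_x2)

lemma refl_poly_0: "refl_poly \<zeta> k 0 = 0"
  by (simp add: refl_poly_def bsubst_0)

lemma refl_poly_power: "refl_poly \<zeta> k (f ^ n) = refl_poly \<zeta> k f ^ n"
  using refl_poly_bconst[of \<zeta> k 1] by (induction n) (simp_all add: refl_poly_mult)

section \<open>Partial derivatives and divided differences (Demazure operators)\<close>

definition derivation :: "('a::comm_semiring_1 \<Rightarrow> 'a) \<Rightarrow> bool" where
  "derivation d \<longleftrightarrow> (\<forall>f g. d (f + g) = d f + d g) \<and> (\<forall>f g. d (f * g) = d f * g + f * d g)"

text \<open>\<open>pd1\<close> acts coefficientwise, so the Leibniz rule follows from the Cauchy
  product formula for the coefficients.\<close>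

lemma derivation_pd1: "derivation (pd1 :: 'a::field bipoly \<Rightarrow> 'a bipoly)"
proof -
  have sum: "pderiv (sum h A) = (\<Sum>i\<in>A. pderiv (h i))" for h :: "nat \<Rightarrow> 'a poly" and A
    by (induction A rule: infinite_finite_induct) (simp_all add: pderiv_add)
  show ?thesis
    by (auto simp: derivation_def pd1_def poly_eq_iff[where 'a = "'a poly"] coeff_map_poly
        coeff_mult pderiv_add pderiv_mult sum sum.distrib mult.commute[of "pderiv _"]
        simp del: coeff_pderiv)
qed

lemma derivation_pd2: "derivation pd2"
  by (simp add: derivation_def pd2_def pderiv_add pderiv_mult algebra_simps)

definition diff_quot :: "'a::field \<Rightarrow> nat \<Rightarrow> 'a bipoly \<Rightarrow> 'a bipoly" where
  "diff_quot \<zeta> k f = (f - refl_poly \<zeta> k f) div root_form \<zeta> k"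

lemma root_form_nonzero: "root_form \<zeta> k \<noteq> 0"
  by (simp add: root_form_def x1_def x2_def bconst_def)

lemma diff_quot_eqI: "f - refl_poly \<zeta> k f = root_form \<zeta> k * q \<Longrightarrow> diff_quot \<zeta> k f = q"
  by (simp add: diff_quot_def root_form_nonzero)

lemma root_form_diff_quot:
  "\<zeta> \<noteq> 0 \<Longrightarrow> root_form \<zeta> k * diff_quot \<zeta> k f = f - refl_poly \<zeta> k f"
  by (simp add: diff_quot_def root_form_dvd)

lemma diff_quot_0 [simp]: "diff_quot \<zeta> k 0 = 0"
  by (simp add: diff_quot_def refl_poly_0)

lemma diff_quot_add:
  "\<zeta> \<noteq> 0 \<Longrightarrow> diff_quot \<zeta> k (f + g) = diff_quot \<zeta> k f + diff_quot \<zeta> k g"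
  by (rule diff_quot_eqI) (simp add: root_form_diff_quot distrib_left refl_poly_add)

text \<open>Divide fg - s(f)s(g) = f(g - s(g)) + (f - s(f))s(g) by the root form. Letting the
  reflection fall on the second factor is what suits \<open>dunkl_vmult\<close>, where that factor
  is a component of the module element.\<close>

lemma diff_quot_mult:
  assumes "\<zeta> \<noteq> 0"
  shows "diff_quot \<zeta> k (f * g) = f * diff_quot \<zeta> k g + diff_quot \<zeta> k f * refl_poly \<zeta> k g"
proof (rule diff_quot_eqI)
  have "root_form \<zeta> k * (f * diff_quot \<zeta> k g + diff_quot \<zeta> k f * refl_poly \<zeta> k g) =
    f * (root_form \<zeta> k * diff_quot \<zeta> k g) + (root_form \<zeta> k * diff_quot \<zeta> k f) * refl_poly \<zeta> k g"
    by (simp only: algebra_simps)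
  also have "\<dots> = f * g - refl_poly \<zeta> k (f * g)"
    by (simp add: root_form_diff_quot assms refl_poly_mult algebra_simps)
  finally show "f * g - refl_poly \<zeta> k (f * g) =
      root_form \<zeta> k * (f * diff_quot \<zeta> k g + diff_quot \<zeta> k f * refl_poly \<zeta> k g)" ..
qed

text \<open>With y = s_k(x1), the root form is x1 - y, and the quotient is the cofactor in the
  factorization of x1^n - y^n. The coefficients are written as k-th powers so that summing over k
  gives geometric sums.\<close>

lemma diff_quot_x1_power:
  "diff_quot \<zeta> k (x1 ^ n) =
    (\<Sum>i<n. bconst ((\<zeta> ^ (n - Suc i)) ^ k) * (x2 ^ (n - Suc i) * x1 ^ i))"
proof (rule diff_quot_eqI)
  have "x1 ^ n - refl_poly \<zeta> k (x1 ^ n) = x1 ^ n - (bconst (\<zeta> ^ k) * x2) ^ n"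
    by (simp add: refl_poly_power refl_poly_x1)
  also have "\<dots> = root_form \<zeta> k * (\<Sum>i<n. (bconst (\<zeta> ^ k) * x2) ^ (n - Suc i) * x1 ^ i)"
    by (simp only: power_diff_sumr2 root_form_def)
  finally show "x1 ^ n - refl_poly \<zeta> k (x1 ^ n) = root_form \<zeta> k *
      (\<Sum>i<n. bconst ((\<zeta> ^ (n - Suc i)) ^ k) * (x2 ^ (n - Suc i) * x1 ^ i))"
    by (simp add: power_mult_distrib bconst_power mult.assoc power_commutes
        flip: power_mult) (simp add: mult.commute)
qed

text \<open>The same factorization, except that x2 - s_k(x2) is -\<zeta>^(-k) times the root form.
  This factor accounts for the sign and for the exponent \<open>n - i\<close> in place of
  \<open>n - Suc i\<close>.\<close>

lemma diff_quot_x2_power: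
  assumes "\<zeta> \<noteq> 0"
  shows "diff_quot \<zeta> k (x2 ^ n) =
    (\<Sum>i<n. bconst (- ((inverse \<zeta> ^ (n - i)) ^ k)) * (x1 ^ (n - Suc i) * x2 ^ i))"
proof (rule diff_quot_eqI)
  let ?b = "bconst (inverse \<zeta> ^ k) :: 'a bipoly"
  have "?b * bconst (\<zeta> ^ k) = 1"
    using assms by (simp flip: bconst_mult power_mult_distrib)
  hence eq: "x2 - ?b * x1 = - ?b * root_form \<zeta> k"
    by (simp add: root_form_def algebra_simps)
  have "x2 ^ n - refl_poly \<zeta> k (x2 ^ n) = x2 ^ n - (?b * x1) ^ n"
    by (simp add: refl_poly_power refl_poly_x2)
  also have "\<dots> = (x2 - ?b * x1) * (\<Sum>i<n. (?b * x1) ^ (n - Suc i) * x2 ^ i)"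
    by (rule power_diff_sumr2)
  also have "\<dots> = root_form \<zeta> k * (\<Sum>i<n. - ?b * ((?b * x1) ^ (n - Suc i) * x2 ^ i))"
    unfolding eq by (simp add: sum_distrib_left sum_negf algebra_simps)
  also have "(\<Sum>i<n. - ?b * ((?b * x1) ^ (n - Suc i) * x2 ^ i)) =
      (\<Sum>i<n. bconst (- ((inverse \<zeta> ^ (n - i)) ^ k)) * (x1 ^ (n - Suc i) * x2 ^ i))"
  proof (rule sum.cong)
    fix i assume "i \<in> {..<n}"
    hence "n - i = Suc (n - Suc i)" by auto
    moreover have "(inverse \<zeta> ^ (n - i)) ^ k = (inverse \<zeta> ^ k) ^ (n - i)"
      by (metis power_mult mult.commute)
    ultimately have "bconst (- ((inverse \<zeta> ^ (n - i)) ^ k)) = - (?b * ?b ^ (n - Suc i))"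
      by (simp only: bconst_minus bconst_mult bconst_power[of "inverse \<zeta> ^ k"] power_Suc)
    thus "- ?b * ((?b * x1) ^ (n - Suc i) * x2 ^ i) =
      bconst (- ((inverse \<zeta> ^ (n - i)) ^ k)) * (x1 ^ (n - Suc i) * x2 ^ i)"
      by (simp only: power_mult_distrib) (simp add: algebra_simps)
  qed simp
  finally show "x2 ^ n - refl_poly \<zeta> k (x2 ^ n) = root_form \<zeta> k *
      (\<Sum>i<n. bconst (- ((inverse \<zeta> ^ (n - i)) ^ k)) * (x1 ^ (n - Suc i) * x2 ^ i))" .
qed

section \<open>Dunkl operators in coordinates and their twisted Leibniz rule\<close>

definition dunkl ::
  "('a bipoly \<Rightarrow> 'a bipoly) \<Rightarrow> (nat \<Rightarrow> 'a) \<Rightarrow> 'a \<Rightarrow> nat \<Rightarrow> nat \<Rightarrow> 'a \<Rightarrow> 'a::field verma \<Rightarrow> 'a verma"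
where
  "dunkl pd r \<zeta> m a c w =
     (pd (fst w) - (\<Sum>k<m. bconst (c * r k * inverse \<zeta> ^ (a * k)) * diff_quot \<zeta> k (snd w)),
      pd (snd w) - (\<Sum>k<m. bconst (c * r k * \<zeta> ^ (a * k)) * diff_quot \<zeta> k (fst w)))"

lemma fst_sum': "fst (sum f A) = (\<Sum>k\<in>A. fst (f k))"
  and snd_sum': "snd (sum f A) = (\<Sum>k\<in>A. snd (f k))"
  for f :: "'b \<Rightarrow> 'c::comm_monoid_add \<times> 'd::comm_monoid_add"
  by (induction A rule: infinite_finite_induct) simp_all

text \<open>A reflection exchanges e1 and e2 up to a power of \<zeta>, so each component receives
  the divided differences of the other one. The common form lets both operators be treated at once,
  with \<open>pd\<close> entering only as a derivation.\<close>

lemma dunkl1_eq: "dunkl1 \<zeta> m a c = dunkl pd1 (\<lambda>k. 1) \<zeta> m a c"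
  and dunkl2_eq: "dunkl2 \<zeta> m a c = dunkl pd2 (\<lambda>k. - (\<zeta> ^ k)) \<zeta> m a c"
proof -
  have *: "dunkl_tensor pd r \<zeta> m a c (fst w) e1 + dunkl_tensor pd r \<zeta> m a c (snd w) e2 =
      dunkl pd r \<zeta> m a c w" for pd r w
    by (simp add: prod_eq_iff dunkl_tensor_def dunkl_def tensor_def e1_def e2_def refl_rho_def
        fst_sum' snd_sum' bconst_mult mult_ac flip: diff_quot_def)
  show "dunkl1 \<zeta> m a c = dunkl pd1 (\<lambda>k. 1) \<zeta> m a c"
    and "dunkl2 \<zeta> m a c = dunkl pd2 (\<lambda>k. - (\<zeta> ^ k)) \<zeta> m a c"
    by (simp_all add: fun_eq_iff dunkl1_def dunkl2_def *)
qed

lemma refl_verma_eq: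
  "refl_verma \<zeta> a k w =
    (bconst (inverse \<zeta> ^ (a * k)) * refl_poly \<zeta> k (snd w),
     bconst (\<zeta> ^ (a * k)) * refl_poly \<zeta> k (fst w))"
  by (simp add: refl_verma_def tensor_def refl_rho_def e1_def e2_def mult.commute)

lemma refl_verma_add: "refl_verma \<zeta> a k (v + w) = refl_verma \<zeta> a k v + refl_verma \<zeta> a k w"
  by (simp add: refl_verma_eq refl_poly_add distrib_left)

lemma vmult_add: "vmult h (v + w) = vmult h v + vmult h w"
  by (simp add: vmult_def distrib_left)

lemma dunkl_add:
  assumes "derivation pd" "\<zeta> \<noteq> 0"
  shows "dunkl pd r \<zeta> m a c (v + w) = dunkl pd r \<zeta> m a c v + dunkl pd r \<zeta> m a c w"
  using assms by (simp add: dunkl_def derivation_def diff_quot_add distrib_left sum.distrib)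

text \<open>Combines the Leibniz rule of \<open>pd\<close> with \<open>diff_quot_mult\<close>. Apart
  from the first term, the right-hand side lies in every submodule over K[x1, x2] that contains
  \<open>w\<close> and is stable under reflections, so Dunkl stability can be tested on
  generators.\<close>

lemma dunkl_vmult:
  assumes "derivation pd" "\<zeta> \<noteq> 0"
  shows "dunkl pd r \<zeta> m a c (vmult h w) =
    vmult h (dunkl pd r \<zeta> m a c w) + vmult (pd h) w -
    (\<Sum>k<m. vmult (bconst (c * r k) * diff_quot \<zeta> k h) (refl_verma \<zeta> a k w))"
  using assms
  by (simp add: prod_eq_iff dunkl_def vmult_def refl_verma_eq fst_sum' snd_sum' derivation_def
      diff_quot_mult algebra_simps sum.distrib sum_distrib_left bconst_mult)

section \<open>Ideals generated by a power of each variable\<close>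

definition mono_ideal :: "nat \<Rightarrow> nat \<Rightarrow> 'a::field bipoly set" where
  "mono_ideal a b = {x1 ^ a * u + x2 ^ b * v | u v. True}"

lemma mono_idealI: "x1 ^ a * u + x2 ^ b * v \<in> mono_ideal a b"
  by (auto simp: mono_ideal_def)

lemma mono_ideal_0 [simp]: "0 \<in> mono_ideal a b"
  using mono_idealI[of a 0 b 0] by simp

lemma mono_ideal_add: "f \<in> mono_ideal a b \<Longrightarrow> g \<in> mono_ideal a b \<Longrightarrow> f + g \<in> mono_ideal a b"
proof -
  assume "f \<in> mono_ideal a b" "g \<in> mono_ideal a b"
  then obtain u v u' v' where "f = x1 ^ a * u + x2 ^ b * v" "g = x1 ^ a * u' + x2 ^ b * v'"
    by (auto simp: mono_ideal_def)
  hence "f + g = x1 ^ a * (u + u') + x2 ^ b * (v + v')" by (simp add: algebra_simps)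
  thus ?thesis by (simp only: mono_idealI)
qed

lemma mono_ideal_mult: "f \<in> mono_ideal a b \<Longrightarrow> h * f \<in> mono_ideal a b"
proof -
  assume "f \<in> mono_ideal a b"
  then obtain u v where "f = x1 ^ a * u + x2 ^ b * v" by (auto simp: mono_ideal_def)
  hence "h * f = x1 ^ a * (h * u) + x2 ^ b * (h * v)" by (simp add: algebra_simps)
  thus ?thesis by (simp only: mono_idealI)
qed

lemma mono_ideal_uminus: "f \<in> mono_ideal a b \<Longrightarrow> - f \<in> mono_ideal a b"
  using mono_ideal_mult[of f a b "-1"] by simp

lemma mono_ideal_sum: "(\<And>i. i \<in> A \<Longrightarrow> f i \<in> mono_ideal a b) \<Longrightarrow> sum f A \<in> mono_ideal a b"
  by (induction A rule: infinite_finite_induct) (simp_all add: mono_ideal_add)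

lemma mono_ideal_x1: "a \<le> i \<Longrightarrow> x1 ^ i * f \<in> mono_ideal a b"
  using mono_idealI[of a "x1 ^ (i - a) * f" b 0] by (simp flip: power_add mult.assoc)

lemma mono_ideal_x2: "b \<le> j \<Longrightarrow> x2 ^ j * f \<in> mono_ideal a b"
  using mono_idealI[of a 0 b "x2 ^ (j - b) * f"] by (simp flip: power_add mult.assoc)

text \<open>A reflection exchanges the variables up to scalars, hence also the two exponents. As it
  exchanges e1 and e2 too, the product of \<open>mono_ideal a b\<close> and
  \<open>mono_ideal b a\<close> is stable.\<close>

lemma mono_ideal_refl_poly: "f \<in> mono_ideal a b \<Longrightarrow> refl_poly \<zeta> k f \<in> mono_ideal b a"
proof -
  assume "f \<in> mono_ideal a b"
  then obtain u v where f: "f = x1 ^ a * u + x2 ^ b * v" by (auto simp: mono_ideal_def)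
  have "refl_poly \<zeta> k f =
    x1 ^ b * (bconst (inverse \<zeta> ^ k) ^ b * refl_poly \<zeta> k v) +
    x2 ^ a * (bconst (\<zeta> ^ k) ^ a * refl_poly \<zeta> k u)"
    by (simp add: f refl_poly_add refl_poly_mult refl_poly_power refl_poly_x1 refl_poly_x2
        power_mult_distrib algebra_simps)
  thus ?thesis by (simp only: mono_idealI)
qed

lemma mono_ideal_coeff:
  assumes "f \<in> mono_ideal a b" "i < a" "j < b"
  shows "coeff (coeff f j) i = 0"
proof -
  obtain u v where "f = x1 ^ a * u + x2 ^ b * v" using assms by (auto simp: mono_ideal_def)
  thus ?thesis using assms by (simp add: x1_power x2_power coeff_monom_mult)
qed

lemma monom_monom_eq: "monom (monom b i) j = bconst b * (x1 ^ i * x2 ^ j)"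
  by (simp add: x1_power x2_power bconst_def smult_monom)

text \<open>The ideal is spanned by monomials: every monomial either lies in it or has coefficient
  zero in \<open>f\<close>, so each summand of the homogeneous component lies in it.\<close>

lemma mono_ideal_bhom:
  fixes f :: "'a::field bipoly"
  assumes "f \<in> mono_ideal a b"
  shows "bhom d f \<in> mono_ideal a b"
  unfolding bhom_def
proof (rule mono_ideal_sum)
  fix j
  show "monom (monom (coeff (coeff f j) (d - j)) (d - j)) j \<in> mono_ideal a b"
  proof (cases "d - j < a \<and> j < b")
    case True
    thus ?thesis using mono_ideal_coeff[OF assms] by simp
  next
    case False
    hence "a \<le> d - j \<or> b \<le> j" by auto
    hence "x1 ^ (d - j) * x2 ^ j \<in> (mono_ideal a b :: 'a bipoly set)"
      using mono_ideal_x1 mono_ideal_x2 by (metis mult.commute)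
    thus ?thesis by (simp only: monom_monom_eq mono_ideal_mult)
  qed
qed

section \<open>Degree 0 components and the maximal proper graded submodule\<close>

lemma bhom_add: "bhom d (f + g) = bhom d f + bhom d g"
  by (simp add: bhom_def sum.distrib flip: add_monom)

lemma bhom_0_left: "bhom 0 f = bconst (coeff (coeff f 0) 0)"
  by (simp add: bhom_def bconst_def monom_0)

lemma dihedral_ops_closed:
  assumes "g \<in> dihedral_ops \<zeta> m a" "\<And>k w. k < m \<Longrightarrow> w \<in> N \<Longrightarrow> refl_verma \<zeta> a k w \<in> N" "w \<in> N"
  shows "g w \<in> N"
  using assms(1,3) by (induction arbitrary: w) (auto intro: assms(2))

lemma dihedral_ops_add:
  assumes "g \<in> dihedral_ops \<zeta> m a"
  shows "g (v + w) = g v + g w"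
  using assms by (induction arbitrary: v w) (simp_all add: refl_verma_add)

text \<open>\<open>verma_submodule\<close> only demands stability under scalars and the two
  variables. A Horner recursion, first in x1 and then in x2, builds every polynomial from
  these.\<close>

lemma verma_submodule_vmult:
  assumes "verma_submodule \<zeta> m a c N" "w \<in> N"
  shows "vmult h w \<in> N"
proof -
  have add: "u + v \<in> N" if "u \<in> N" "v \<in> N" for u v
    using assms(1) that by (simp add: verma_submodule_def)
  have const: "vmult (bconst b) v \<in> N" and x1: "vmult x1 v \<in> N" and x2: "vmult x2 v \<in> N"
    if "v \<in> N" for b v
    using assms(1) that by (simp_all add: verma_submodule_def)
  have zero: "vmult 0 w \<in> N"
    using const[OF assms(2), of 0] by simp
  have inner: "vmult [:g:] w \<in> N" for g
  proof (induction g)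
    case 0
    thus ?case using zero by simp
  next
    case (pCons b g)
    have "[:pCons b g:] = bconst b + x1 * [:g:]"
      by (simp add: bconst_def x1_def)
    hence "vmult [:pCons b g:] w = vmult (bconst b) w + vmult x1 (vmult [:g:] w)"
      by (simp only: vmult_def prod_eq_iff fst_add snd_add fst_conv snd_conv distrib_right mult.assoc)
    thus ?case using pCons const[OF assms(2)] x1 add by simp
  qed
  show ?thesis
  proof (induction h)
    case 0
    thus ?case using zero by simp
  next
    case (pCons g h)
    have "pCons g h = [:g:] + x2 * h"
      by (simp add: x2_def)
    hence "vmult (pCons g h) w = vmult [:g:] w + vmult x2 (vmult h w)"
      by (simp only: vmult_def prod_eq_iff fst_add snd_add fst_conv snd_conv distrib_right mult.assoc)
    thus ?case using pCons inner x2 add by simp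
  qed
qed

text \<open>
  The condition \<open>\<zeta> ^ (2 * a) \<noteq> 1\<close> makes \<open>\<rho>\<^sub>a\<close> irreducible, as \<open>s\<^sub>0 s\<^sub>1\<close> then acts
  with two distinct eigenvalues whose eigenvectors are exchanged by \<open>s\<^sub>0\<close>.
\<close>

lemma proper_graded_submodule_const_coeff:
  fixes \<zeta> :: "'a::field"
  assumes N: "proper_graded_submodule \<zeta> m a c N" and w: "w \<in> N"
    and \<zeta>: "\<zeta> \<noteq> 0" "\<zeta> ^ (2 * a) \<noteq> 1" and m: "m > 1"
  shows "coeff (coeff (fst w) 0) 0 = 0 \<and> coeff (coeff (snd w) 0) 0 = 0"
proof (rule ccontr)
  let ?u = "coeff (coeff (fst w) 0) 0" and ?v = "coeff (coeff (snd w) 0) 0"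
  assume nz: "\<not> (?u = 0 \<and> ?v = 0)"
  have sub: "verma_submodule \<zeta> m a c N" and gr: "verma_graded N" and proper: "N \<noteq> UNIV"
    using N by (simp_all add: proper_graded_submodule_def)
  have add: "u + v \<in> N" if "u \<in> N" "v \<in> N" for u v
    using sub that by (simp add: verma_submodule_def)
  have refl: "refl_verma \<zeta> a k v \<in> N" if "v \<in> N" "k < m" for k v
    using sub that dihedral_ops.refl[of k m \<zeta> a] by (simp add: verma_submodule_def)
  note vm = verma_submodule_vmult[OF sub]
  \<comment> \<open>On constants s_0 just exchanges the two components, since \<zeta>^0 = 1.\<close>
  have refl0: "(g, f) \<in> N" if "(f, g) \<in> N" "f = bconst s" "g = bconst t" for f g s t
    using refl[OF that(1), of 0] m that by (simp add: refl_verma_eq refl_poly_bconst)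
  have key: "(1, 0) \<in> N" if st: "(bconst s, bconst t) \<in> N" "s \<noteq> 0" for s t
  proof -
    let ?i = "inverse \<zeta> ^ a"
    \<comment> \<open>s_1 followed by s_0 acts on constants as the diagonal matrix with entries
      \<zeta>^a and \<zeta>^(-a). Subtracting \<zeta>^(-a) times the original vector kills the
      second component and leaves a nonzero multiple of e1.\<close>
    have "(bconst (?i * t), bconst (\<zeta> ^ a * s)) \<in> N"
      using refl[OF st(1), of 1] m by (simp add: refl_verma_eq refl_poly_bconst bconst_mult)
    from refl0[OF this] have "(bconst (\<zeta> ^ a * s), bconst (?i * t)) \<in> N"
      by simp
    from add[OF this vm[OF st(1), of "bconst (- ?i)"]]
    have *: "(bconst ((\<zeta> ^ a - ?i) * s), 0) \<in> N"
      by (simp add: vmult_def algebra_simps flip: bconst_mult bconst_add)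
    have "\<zeta> ^ a \<noteq> ?i"
    proof
      assume "\<zeta> ^ a = ?i"
      hence "\<zeta> ^ a * \<zeta> ^ a = 1" using \<zeta>(1) by (simp add: field_simps)
      thus False using \<zeta>(2) by (simp add: mult_2 power_add)
    qed
    hence "inverse ((\<zeta> ^ a - ?i) * s) * ((\<zeta> ^ a - ?i) * s) = 1"
      using st(2) by (intro left_inverse) simp
    thus ?thesis
      using vm[OF *, of "bconst (inverse ((\<zeta> ^ a - ?i) * s))"]
      by (simp only: vmult_def fst_conv snd_conv mult_zero_right bconst_1 flip: bconst_mult)
  qed
  \<comment> \<open>The grading isolates the degree 0 component of \<open>w\<close>.\<close>
  have "(bconst ?u, bconst ?v) \<in> N"
    using gr w by (metis verma_graded_def bhom_0_left)
  \<comment> \<open>If \<open>?u\<close> is zero, \<open>refl0\<close> first moves the nonzero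
    \<open>?v\<close> into the first component.\<close>
  hence e1: "(1, 0) \<in> N"
    using nz key refl0 by blast
  hence e2: "(0, 1) \<in> N"
    using refl0[of 1 0 1 0] by simp
  have "z \<in> N" for z
    using add[OF vm[OF e1, of "fst z"] vm[OF e2, of "snd z"]] by (simp add: vmult_def)
  thus False using proper by blast
qed

text \<open>Stability holds because all operators are additive. Properness is the substantial point:
  elements of both summands have zero constant coefficients, so (1, 0) cannot be a sum of two of
  them.\<close>

lemma proper_graded_submodule_sum:
  assumes N: "proper_graded_submodule \<zeta> m a c N" and N': "proper_graded_submodule \<zeta> m a c N'"
    and \<zeta>: "\<zeta> \<noteq> 0" "\<zeta> ^ (2 * a) \<noteq> 1" and m: "m > 1"
  shows "proper_graded_submodule \<zeta> m a c {v + w | v w. v \<in> N \<and> w \<in> N'}" (is "proper_graded_submodule _ _ _ _ ?S")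
proof -
  have sub: "verma_submodule \<zeta> m a c N" "verma_submodule \<zeta> m a c N'"
    and gr: "verma_graded N" "verma_graded N'"
    using N N' by (simp_all add: proper_graded_submodule_def)
  have op: "g z \<in> ?S"
    if z: "z \<in> ?S" and g: "\<And>v w. g (v + w) = g v + g w" "\<And>v. v \<in> N \<Longrightarrow> g v \<in> N" "\<And>v. v \<in> N' \<Longrightarrow> g v \<in> N'"
    for g z
  proof -
    obtain v w where "z = v + w" "v \<in> N" "w \<in> N'" using z by blast
    hence "g z = g v + g w" "g v \<in> N" "g w \<in> N'" using g by simp_all
    thus ?thesis by blast
  qed
  note vm = sub[THEN verma_submodule_vmult]
  have closed: "(\<forall>g\<in>dihedral_ops \<zeta> m a. \<forall>w\<in>A. g w \<in> A) \<and>
      (\<forall>w\<in>A. dunkl1 \<zeta> m a c w \<in> A \<and> dunkl2 \<zeta> m a c w \<in> A)"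
    if "verma_submodule \<zeta> m a c A" for A
    using that unfolding verma_submodule_def by (elim conjE) (intro conjI)
  note d = dunkl_add[OF derivation_pd1 \<zeta>(1)] dunkl_add[OF derivation_pd2 \<zeta>(1)]
  have "verma_submodule \<zeta> m a c ?S"
    unfolding verma_submodule_def
  proof (intro conjI ballI allI)
    have "0 + 0 \<in> ?S" using sub unfolding verma_submodule_def by blast
    thus "0 \<in> ?S" by simp
    fix z assume z: "z \<in> ?S"
    show "vmult (bconst b) z \<in> ?S" for b
      by (rule op[OF z vmult_add]) (simp_all add: vm)
    show "vmult x1 z \<in> ?S" "vmult x2 z \<in> ?S"
      by (rule op[OF z vmult_add]; simp add: vm)+
    show "g z \<in> ?S" if "g \<in> dihedral_ops \<zeta> m a" for g
      by (rule op[OF z dihedral_ops_add[OF that]]) (use sub[THEN closed] that in blast)+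
    show "dunkl1 \<zeta> m a c z \<in> ?S"
      by (rule op[where g = "dunkl1 \<zeta> m a c", OF z]) (simp add: dunkl1_eq d, (use sub[THEN closed] in blast)+)
    show "dunkl2 \<zeta> m a c z \<in> ?S"
      by (rule op[where g = "dunkl2 \<zeta> m a c", OF z]) (simp add: dunkl2_eq d, (use sub[THEN closed] in blast)+)
    fix z' assume "z' \<in> ?S"
    then obtain v w v' w' where *: "z = v + w" "z' = v' + w'" "v \<in> N" "v' \<in> N" "w \<in> N'" "w' \<in> N'"
      using z by blast
    hence "z + z' = (v + v') + (w + w')" "v + v' \<in> N" "w + w' \<in> N'"
      using sub by (simp_all add: verma_submodule_def add_ac)
    thus "z + z' \<in> ?S" by blast
  qed
  moreover have "verma_graded ?S"
    unfolding verma_graded_def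
  proof (intro ballI allI)
    fix z d assume "z \<in> ?S"
    thus "(bhom d (fst z), bhom d (snd z)) \<in> ?S"
      by (rule op[where g = "\<lambda>z. (bhom d (fst z), bhom d (snd z))"])
        (use gr in \<open>simp_all add: verma_graded_def bhom_add\<close>)
  qed
  moreover have "(1, 0) \<notin> ?S"
  proof
    assume "(1, 0) \<in> ?S"
    then obtain v w where vw: "1 = fst v + fst w" "v \<in> N" "w \<in> N'"
      by (auto simp: prod_eq_iff)
    have "coeff (coeff (fst v + fst w) 0) 0 = 1" by (simp flip: vw(1))
    thus False
      using proper_graded_submodule_const_coeff[OF N vw(2) \<zeta> m]
        proper_graded_submodule_const_coeff[OF N' vw(3) \<zeta> m] by simp
  qed
  ultimately show ?thesis unfolding proper_graded_submodule_def by blast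
qed

text \<open>The union of all proper graded submodules is again one: two of its elements lie in a
  common proper graded submodule, the sum of theirs, and (1, 0) lies in none.\<close>

lemma proper_graded_submodule_subset_J:
  assumes N: "proper_graded_submodule \<zeta> m a c N"
    and \<zeta>: "\<zeta> \<noteq> 0" "\<zeta> ^ (2 * a) \<noteq> 1" and m: "m > 1"
  shows "N \<subseteq> J \<zeta> m a c"
proof -
  let ?P = "proper_graded_submodule \<zeta> m a c"
  let ?U = "\<Union>{N. ?P N}"
  have sum: "z + z' \<in> ?U" if zz: "z \<in> ?U" "z' \<in> ?U" for z z'
  proof -
    obtain A B where "?P A" "?P B" "z \<in> A" "z' \<in> B" using zz by blast
    with proper_graded_submodule_sum[OF this(1,2) \<zeta> m] show ?thesis by blast
  qed
  have zero: "0 \<in> ?U"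
    using N unfolding proper_graded_submodule_def verma_submodule_def by blast
  have "verma_submodule \<zeta> m a c ?U"
    unfolding verma_submodule_def
  proof (intro conjI ballI allI)
    fix z assume "z \<in> ?U"
    then obtain A where A: "z \<in> A" "A \<subseteq> ?U" "verma_submodule \<zeta> m a c A"
      by (auto simp: proper_graded_submodule_def)
    show "vmult (bconst b) z \<in> ?U" for b
      using A verma_submodule_vmult by blast
    show "vmult x1 z \<in> ?U" "vmult x2 z \<in> ?U"
      using A verma_submodule_vmult by blast+
    show "g z \<in> ?U" if "g \<in> dihedral_ops \<zeta> m a" for g
      using A that unfolding verma_submodule_def by blast
    show "dunkl1 \<zeta> m a c z \<in> ?U" "dunkl2 \<zeta> m a c z \<in> ?U"
      using A unfolding verma_submodule_def by blast+
  qed (use zero sum in auto)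
  moreover have "verma_graded ?U"
    unfolding verma_graded_def proper_graded_submodule_def by blast
  moreover have "(1, 0) \<notin> ?U"
    using proper_graded_submodule_const_coeff[OF _ _ \<zeta> m] by fastforce
  ultimately have U: "?P ?U"
    by (auto simp: proper_graded_submodule_def)
  \<comment> \<open>\<open>?U\<close> contains every proper graded submodule, so it is maximal and
    equals any other maximal one; this gives the existence and uniqueness behind
    \<open>THE\<close>.\<close>
  hence "J \<zeta> m a c = ?U"
    unfolding J_def maximal_proper_graded_submodule_def by (intro the_equality) blast+
  thus ?thesis using N by blast
qed

section \<open>The candidate submodule and its stability under Dunkl operators\<close>

definition mono_submodule :: "nat \<Rightarrow> nat \<Rightarrow> 'a::field verma set" where
  "mono_submodule a b = mono_ideal a b \<times> mono_ideal b a"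

lemma mono_submodule_add:
    "v \<in> mono_submodule a b \<Longrightarrow> w \<in> mono_submodule a b \<Longrightarrow> v + w \<in> mono_submodule a b"
  and mono_submodule_uminus: "w \<in> mono_submodule a b \<Longrightarrow> - w \<in> mono_submodule a b"
  and mono_submodule_vmult: "w \<in> mono_submodule a b \<Longrightarrow> vmult h w \<in> mono_submodule a b"
  and mono_submodule_refl: "w \<in> mono_submodule a b \<Longrightarrow> refl_verma \<zeta> l k w \<in> mono_submodule a b"
  by (auto simp: mono_submodule_def mono_ideal_add mono_ideal_mult mono_ideal_uminus vmult_def
      refl_verma_eq mono_ideal_refl_poly)

lemma mono_submodule_sum:
  "(\<And>i. i \<in> A \<Longrightarrow> f i \<in> mono_submodule a b) \<Longrightarrow> sum f A \<in> mono_submodule a b"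
  by (induction A rule: infinite_finite_induct)
    (simp_all add: mono_submodule_add, simp_all add: mono_submodule_def zero_prod_def)

lemma mono_submodule_dunkl:
  assumes pd: "derivation pd" and \<zeta>: "\<zeta> \<noteq> 0"
    and gens: "dunkl pd r \<zeta> m l c (x1 ^ a, 0) \<in> mono_submodule a b"
      "dunkl pd r \<zeta> m l c (x2 ^ b, 0) \<in> mono_submodule a b"
      "dunkl pd r \<zeta> m l c (0, x1 ^ b) \<in> mono_submodule a b"
      "dunkl pd r \<zeta> m l c (0, x2 ^ a) \<in> mono_submodule a b"
    and w: "w \<in> mono_submodule a b"
  shows "dunkl pd r \<zeta> m l c w \<in> mono_submodule a b"
proof -
  let ?D = "dunkl pd r \<zeta> m l c"
  obtain f1 f2 g1 g2 where "w = (x1 ^ a * f1 + x2 ^ b * f2, x1 ^ b * g1 + x2 ^ a * g2)"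
    using w by (auto simp: mono_submodule_def mono_ideal_def)
  hence w_eq: "w = vmult f1 (x1 ^ a, 0) + vmult f2 (x2 ^ b, 0) +
      vmult g1 (0, x1 ^ b) + vmult g2 (0, x2 ^ a)"
    by (simp add: vmult_def mult.commute)
  have mem: "(x1 ^ a, 0) \<in> mono_submodule a b" "(x2 ^ b, 0) \<in> mono_submodule a b"
    "(0, x1 ^ b) \<in> mono_submodule a b" "(0, x2 ^ a) \<in> mono_submodule a b"
    using mono_ideal_x1[of a a 1 b] mono_ideal_x2[of b b 1 a]
      mono_ideal_x1[of b b 1 a] mono_ideal_x2[of a a 1 b]
    by (simp_all add: mono_submodule_def)
  \<comment> \<open>In \<open>dunkl_vmult\<close> only the term \<open>vmult h (?D v)\<close>
    involves the operator on \<open>v\<close>; the others are multiples of \<open>v\<close> and of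
    its reflections.\<close>
  have *: "?D (vmult h v) \<in> mono_submodule a b"
    if "v \<in> mono_submodule a b" "?D v \<in> mono_submodule a b" for h v
    unfolding dunkl_vmult[OF pd \<zeta>] diff_conv_add_uminus
    by (intro mono_submodule_add mono_submodule_uminus mono_submodule_sum mono_submodule_vmult
        mono_submodule_refl that)
  show ?thesis
    unfolding w_eq dunkl_add[OF pd \<zeta>]
    by (intro mono_submodule_add * mem gens)
qed

text \<open>
  Summing over the reflections turns the coefficient of each monomial of a divided difference into
  a geometric sum over \<open>m\<close>-th roots of unity, which vanishes unless its ratio is \<open>1\<close>.
\<close>

lemma sum_diff_quot_mem_mono_ideal:
  fixes \<rho> \<beta> :: "'a::field"
  assumes "\<And>k. diff_quot \<zeta> k f = (\<Sum>i<n. bconst (\<epsilon> * q i ^ k) * M i)"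
    and "\<And>k. \<kappa> k = s * (\<rho> * \<beta>) ^ k"
    and "\<And>i. i < n \<Longrightarrow> (\<rho> * \<beta> * q i) ^ m = 1"
    and "\<And>i. i < n \<Longrightarrow> \<rho> * \<beta> * q i \<noteq> 1 \<or> M i \<in> mono_ideal a b"
  shows "(\<Sum>k<m. bconst (\<kappa> k) * diff_quot \<zeta> k f) \<in> mono_ideal a b"
proof -
  \<comment> \<open>\<open>\<rho>\<close> stands for the contribution of the pairing,
    \<open>\<beta>\<close> for that of the representation and \<open>q i\<close> for that of the
    divided difference; their product is the ratio of the geometric sum.\<close>
  have "(\<Sum>k<m. bconst (\<kappa> k) * diff_quot \<zeta> k f) =
    (\<Sum>k<m. \<Sum>i<n. bconst (s * \<epsilon> * (\<rho> * \<beta> * q i) ^ k) * M i)"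
    by (simp add: assms(1,2) sum_distrib_left power_mult_distrib mult_ac bconst_mult)
  also have "\<dots> = (\<Sum>i<n. \<Sum>k<m. bconst (s * \<epsilon> * (\<rho> * \<beta> * q i) ^ k) * M i)"
    by (rule sum.swap)
  also have "\<dots> = (\<Sum>i<n. bconst (s * \<epsilon> * (\<Sum>k<m. (\<rho> * \<beta> * q i) ^ k)) * M i)"
    by (simp add: sum_distrib_left sum_distrib_right bconst_sum)
  also have "\<dots> \<in> mono_ideal a b"
  proof (rule mono_ideal_sum)
    fix i assume i: "i \<in> {..<n}"
    show "bconst (s * \<epsilon> * (\<Sum>k<m. (\<rho> * \<beta> * q i) ^ k)) * M i \<in> mono_ideal a b"
    proof (cases "\<rho> * \<beta> * q i = 1")
      case True
      thus ?thesis using assms(4)[of i] i by (auto intro: mono_ideal_mult)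
    next
      case False
      hence "(\<Sum>k<m. (\<rho> * \<beta> * q i) ^ k) = 0"
        using assms(3)[of i] i by (simp add: geometric_sum)
      thus ?thesis by simp
    qed
  qed
  finally show ?thesis .
qed

lemma derivation_power:
  assumes "derivation d"
  shows "d (f ^ Suc n) = of_nat (Suc n) * f ^ n * d f"
  using assms by (induction n) (simp_all add: derivation_def algebra_simps)

lemma derivation_0:
  fixes d :: "'a::comm_ring_1 \<Rightarrow> 'a"
  shows "derivation d \<Longrightarrow> d 0 = 0"
  by (metis add_cancel_right_right derivation_def)

text \<open>The values t = 0 and t = 1 cover the two pairings 1 and -\<zeta>^k. For i < p each ratio
  is \<zeta>^e or \<zeta>^(-e) with e between p and 2p, hence not 1 as 2p < m. For i \<ge> p, which
  occurs only for the powers 3p, the monomial contains a p-th power lying in the ideal.\<close>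

lemma mono_submodule_dunkl_closed:
  fixes \<zeta> c :: "'a::field"
  assumes "prime p" "2 * p < m" and char: "CHAR('a) = p" and \<zeta>: "primitive_unity_root m \<zeta>"
    and pd: "derivation pd" and r: "\<And>k. r k = s * (\<zeta> ^ t) ^ k" and t: "t \<le> 1"
    and w: "w \<in> mono_submodule p (3 * p)"
  shows "dunkl pd r \<zeta> m p c w \<in> mono_submodule p (3 * p)"
proof -
  have p: "p > 0" using assms(1) by (rule prime_gt_0_nat)
  have prim: "\<zeta> ^ j \<noteq> 1" if "0 < j" "j < m" for j
    using \<zeta> that unfolding primitive_unity_root_def by blast
  have \<zeta>m: "\<zeta> ^ m = 1" "\<zeta> \<noteq> 0"
    using \<zeta> by (auto simp: primitive_unity_root_def power_0_left)
  have inv_prim: "inverse \<zeta> ^ j \<noteq> 1" if "0 < j" "j < m" for j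
    using prim[OF that] by (metis power_inverse inverse_inverse_eq inverse_1)
  have unity: "(\<zeta> ^ i) ^ m = 1" "(inverse \<zeta> ^ i) ^ m = 1" for i
  proof -
    have "(x ^ i) ^ m = (x ^ m) ^ i" for x :: 'a
      by (metis mult.commute power_mult)
    thus "(\<zeta> ^ i) ^ m = 1" "(inverse \<zeta> ^ i) ^ m = 1"
      by (simp_all only: power_inverse \<zeta>m(1) power_one inverse_1)
  qed
  \<comment> \<open>Exponents are natural numbers, so the sign of i - j decides which base
    remains.\<close>
  have cancel: "\<zeta> ^ i * inverse \<zeta> ^ j = (if i \<le> j then inverse \<zeta> ^ (j - i) else \<zeta> ^ (i - j))" for i j
    using \<zeta>m(2) by (auto simp: power_inverse field_simps simp flip: power_add)
  have pd_0: "pd 0 = 0"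
    using derivation_0 pd by blast
  have pd_power: "pd (f ^ p) = 0" "pd (f ^ (3 * p)) = 0" for f
  proof -
    \<comment> \<open>The factor n in the derivative of an n-th power vanishes in characteristic
      p.\<close>
    have "pd (f ^ n) = 0" if "n > 0" "p dvd n" for n
    proof -
      have "of_nat n = (0 :: 'a)" using that char of_nat_eq_0_iff_char_dvd by blast
      hence "of_nat n = (0 :: 'a bipoly)" by (simp add: of_nat_poly)
      thus ?thesis using derivation_power[OF pd, of f "n - 1"] that by simp
    qed
    thus "pd (f ^ p) = 0" "pd (f ^ (3 * p)) = 0" using p by simp_all
  qed
  have \<kappa>: "c * r k * \<zeta> ^ (p * k) = (c * s) * (\<zeta> ^ t * \<zeta> ^ p) ^ k"
    "c * r k * inverse \<zeta> ^ (p * k) = (c * s) * (\<zeta> ^ t * inverse \<zeta> ^ p) ^ k" for k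
    by (simp_all only: r power_mult power_mult_distrib mult.assoc)
  have dq1: "diff_quot \<zeta> k (x1 ^ n) =
    (\<Sum>i<n. bconst (1 * (\<zeta> ^ (n - Suc i)) ^ k) * (x2 ^ (n - Suc i) * x1 ^ i))" for k n
    by (simp only: diff_quot_x1_power mult_1)
  have dq2: "diff_quot \<zeta> k (x2 ^ n) =
    (\<Sum>i<n. bconst (- 1 * (inverse \<zeta> ^ (n - i)) ^ k) * (x1 ^ (n - Suc i) * x2 ^ i))" for k n
    by (simp only: diff_quot_x2_power[OF \<zeta>m(2)] mult_minus1)
  \<comment> \<open>\<open>A\<close>, \<open>B\<close>, \<open>C\<close>, \<open>D\<close> treat the
    generators x1^p \<otimes> e1, x1^(3p) \<otimes> e2, x2^p \<otimes> e2 and x2^(3p) \<otimes> e1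
    in turn; each image lies in the component opposite to its generator.\<close>
  have A: "(\<Sum>k<m. bconst (c * r k * \<zeta> ^ (p * k)) * diff_quot \<zeta> k (x1 ^ p)) \<in> mono_ideal (3 * p) p"
  proof (rule sum_diff_quot_mem_mono_ideal[OF dq1 \<kappa>(1)])
    fix i assume i: "i < p"
    have "\<zeta> ^ t * \<zeta> ^ p * \<zeta> ^ (p - Suc i) = \<zeta> ^ (t + p + (p - Suc i))"
      by (simp only: power_add)
    \<comment> \<open>The largest exponent is 2p, reached for t = 1 and i = 0.\<close>
    also have "\<dots> \<noteq> 1"
      using i t assms(2) by (intro prim) auto
    finally show "\<zeta> ^ t * \<zeta> ^ p * \<zeta> ^ (p - Suc i) \<noteq> 1 \<or>
        x2 ^ (p - Suc i) * x1 ^ i \<in> (mono_ideal (3 * p) p :: 'a bipoly set)" ..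
  qed (simp add: power_mult_distrib unity)
  have B: "(\<Sum>k<m. bconst (c * r k * inverse \<zeta> ^ (p * k)) * diff_quot \<zeta> k (x1 ^ (3 * p)))
      \<in> mono_ideal p (3 * p)"
  proof (rule sum_diff_quot_mem_mono_ideal[OF dq1 \<kappa>(2)])
    fix i assume i: "i < 3 * p"
    show "\<zeta> ^ t * inverse \<zeta> ^ p * \<zeta> ^ (3 * p - Suc i) \<noteq> 1 \<or>
        x2 ^ (3 * p - Suc i) * x1 ^ i \<in> (mono_ideal p (3 * p) :: 'a bipoly set)"
    proof (cases "i < p")
      case True
      have "\<zeta> ^ t * inverse \<zeta> ^ p * \<zeta> ^ (3 * p - Suc i) = \<zeta> ^ (t + (3 * p - Suc i)) * inverse \<zeta> ^ p"
        by (simp add: power_add)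
      also have "\<dots> = \<zeta> ^ (t + (3 * p - Suc i) - p)"
        unfolding cancel using True by auto
      also have "\<dots> \<noteq> 1"
        by (rule prim) (use True t assms(2) in auto)
      finally show ?thesis ..
    next
      case False
      thus ?thesis using mono_ideal_x1 by (metis mult.commute not_less)
    qed
  qed (simp add: power_mult_distrib unity)
  have C: "(\<Sum>k<m. bconst (c * r k * inverse \<zeta> ^ (p * k)) * diff_quot \<zeta> k (x2 ^ p))
      \<in> mono_ideal p (3 * p)"
  proof (rule sum_diff_quot_mem_mono_ideal[OF dq2 \<kappa>(2)])
    fix i assume i: "i < p"
    have "\<zeta> ^ t * inverse \<zeta> ^ p * inverse \<zeta> ^ (p - i) = \<zeta> ^ t * inverse \<zeta> ^ (p + (p - i))"
      by (simp add: power_add)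
    also have "\<dots> = inverse \<zeta> ^ (p + (p - i) - t)"
      unfolding cancel using i t by auto
    also have "\<dots> \<noteq> 1"
      by (rule inv_prim) (use i t assms(2) in auto)
    finally show "\<zeta> ^ t * inverse \<zeta> ^ p * inverse \<zeta> ^ (p - i) \<noteq> 1 \<or>
        x1 ^ (p - Suc i) * x2 ^ i \<in> (mono_ideal p (3 * p) :: 'a bipoly set)" ..
  qed (simp add: power_mult_distrib unity)
  have D: "(\<Sum>k<m. bconst (c * r k * \<zeta> ^ (p * k)) * diff_quot \<zeta> k (x2 ^ (3 * p)))
      \<in> mono_ideal (3 * p) p"
  proof (rule sum_diff_quot_mem_mono_ideal[OF dq2 \<kappa>(1)])
    fix i assume i: "i < 3 * p"
    show "\<zeta> ^ t * \<zeta> ^ p * inverse \<zeta> ^ (3 * p - i) \<noteq> 1 \<or>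
        x1 ^ (3 * p - Suc i) * x2 ^ i \<in> (mono_ideal (3 * p) p :: 'a bipoly set)"
    proof (cases "i < p")
      case True
      have "\<zeta> ^ t * \<zeta> ^ p * inverse \<zeta> ^ (3 * p - i) = \<zeta> ^ (t + p) * inverse \<zeta> ^ (3 * p - i)"
        by (simp add: power_add)
      also have "\<dots> = inverse \<zeta> ^ (3 * p - i - (t + p))"
        unfolding cancel using True t by auto
      also have "\<dots> \<noteq> 1"
        by (rule inv_prim) (use True t assms(2) in auto)
      finally show ?thesis ..
    next
      case False
      thus ?thesis using mono_ideal_x2 by (metis mult.commute not_less)
    qed
  qed (simp add: power_mult_distrib unity)
  show ?thesis
    by (rule mono_submodule_dunkl[OF pd \<zeta>m(2) _ _ _ _ w])
      (use A B C D in \<open>simp_all add: dunkl_def mono_submodule_def pd_0 pd_power mono_ideal_uminus\<close>)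
qed

lemma proper_graded_mono_submodule:
  fixes \<zeta> c :: "'a::field"
  assumes "prime p" "2 * p < m" "CHAR('a) = p" "primitive_unity_root m \<zeta>"
  shows "proper_graded_submodule \<zeta> m p c (mono_submodule p (3 * p))" (is "proper_graded_submodule _ _ _ _ ?N")
proof -
  have "verma_submodule \<zeta> m p c ?N"
    unfolding verma_submodule_def
  proof (intro conjI ballI allI)
    show "0 \<in> ?N" by (simp add: mono_submodule_def zero_prod_def)
    fix w :: "'a verma" assume w: "w \<in> ?N"
    show "g w \<in> ?N" if "g \<in> dihedral_ops \<zeta> m p" for g
      using dihedral_ops_closed[OF that _ w] mono_submodule_refl by blast
    show "dunkl1 \<zeta> m p c w \<in> ?N"
      unfolding dunkl1_eq
      by (rule mono_submodule_dunkl_closed[where s = 1 and t = 0, OF assms derivation_pd1 _ _ w]) simp_all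
    show "dunkl2 \<zeta> m p c w \<in> ?N"
      unfolding dunkl2_eq
      by (rule mono_submodule_dunkl_closed[where s = "- 1" and t = 1, OF assms derivation_pd2 _ _ w]) simp_all
  qed (simp_all add: mono_submodule_add mono_submodule_vmult)
  moreover have "verma_graded ?N"
    by (auto simp: verma_graded_def mono_submodule_def mono_ideal_bhom)
  \<comment> \<open>Both exponents are positive, so elements of the ideal have constant coefficient
    0.\<close>
  moreover have "(1, 0) \<notin> ?N"
    using mono_ideal_coeff[of 1 p "3 * p" 0 0] prime_gt_0_nat[OF assms(1)]
    by (auto simp: mono_submodule_def)
  ultimately show ?thesis by (auto simp: proper_graded_submodule_def)
qed

theorem theorem4p4:
  fixes p m :: nat and \<zeta> c :: "'a::field"
  assumes "prime p"
    and "odd m"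
    and "\<not> p dvd m"
    and "real p < real m / 2"
    and "CHAR('a) = p"
    and "primitive_unity_root m \<zeta>"
  shows "{tensor (x1 ^ p) e1, tensor (x2 ^ p) e2,
          tensor (x1 ^ (3 * p)) e2, tensor (x2 ^ (3 * p)) e1} \<subseteq> J \<zeta> m p c"
proof -
  have pm: "2 * p < m" using assms(4) by linarith
  have p: "p > 0" using assms(1) by (rule prime_gt_0_nat)
  \<comment> \<open>Since 0 < 2p < m, primitivity of \<zeta> yields the irreducibility condition for
    \<open>\<rho>\<^sub>p\<close>.\<close>
  have \<zeta>: "\<zeta> \<noteq> 0" "\<zeta> ^ (2 * p) \<noteq> 1"
    using assms(6) pm p by (auto simp: primitive_unity_root_def power_0_left)
  have "{tensor (x1 ^ p) e1, tensor (x2 ^ p) e2,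
      tensor (x1 ^ (3 * p)) e2, tensor (x2 ^ (3 * p)) e1} \<subseteq> mono_submodule p (3 * p)"
    using mono_ideal_x1[of p p 1 "3 * p"] mono_ideal_x2[of "3 * p" "3 * p" 1 p]
      mono_ideal_x1[of "3 * p" "3 * p" 1 p] mono_ideal_x2[of p p 1 "3 * p"]
    by (simp add: tensor_def e1_def e2_def mono_submodule_def)
  also have "\<dots> \<subseteq> J \<zeta> m p c"
    using proper_graded_submodule_subset_J[OF proper_graded_mono_submodule[OF assms(1) pm assms(5,6)] \<zeta>]
      pm p by simp
  finally show ?thesis .
qed

end
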